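(* Let $(X,d_X,\leq_{P_1})$ and $(Y,d_Y,\leq_{P_2})$ be two partially ordered complete metric spaces and let $F:X\times Y\rightarrow X$, $G:Y\times X\rightarrow Y$ be two continuous mappings having the mixed monotone property. Assume that there exist $k,l,m,n\in [0,1)$ with $k+l<1$ and $m+n<1$ such that $$d_X(F(x,y),F(u,v))\leq k\, d_X(x,u)+l\, d_Y(y,v)\quad \text{for all } x,u\in X,\ y,v\in Y \text{ with } x\geq_{P_1}u,\ y\leq_{P_2}v,$$ $$d_Y(G(y,x),G(v,u))\leq m\, d_Y(y,v)+n\, d_X(x,u)\quad \text{for all } x,u\in X,\ y,v\in Y \text{ with } x\leq_{P_1}u,\ y\geq_{P_2}v.$$ If there exist $x_0\in X$, $y_0\in Y$ such that $x_0\leq_{P_1} F(x_0, y_0)$ and $y_0\geq_{P_2} G(y_0, x_0)$, then there exists $(x,y)\in X\times Y$ such that $x=F(x,y)$ and $y=G(y,x)$.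
   Context: A partially ordered complete metric space $(X,d_X,\leq_{P_1})$ is a set $X$ with a metric $d_X$ for which it is complete and a partial order $\leq_{P_1}$ (no compatibility between them is assumed). The product $X\times Y$ carries the metric $d((x,y),(u,v))=d_X(x,u)+d_Y(y,v)$ (similarly for $Y\times X$). The maps $F:X\times Y\to X$ and $G:Y\times X\to Y$ have the mixed monotone property if for all $x\in X$, $y\in Y$: for all $x_1,x_2\in X$, $x_1\leq_{P_1} x_2$ implies $F(x_1,y)\leq_{P_1} F(x_2,y)$ and $G(y,x_1)\geq_{P_2}G(y,x_2)$; and for all $y_1,y_2\in Y$, $y_1\leq_{P_2}y_2$ implies $F(x,y_1)\geq_{P_1}F(x,y_2)$ and $G(y_1,x)\leq_{P_2}G(y_2,x)$. *)

theory Defs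
  imports "HOL-Analysis.Analysis"
begin

(* The library's prod_metric carries the Euclidean combination of the two distances;
   the product metric here is their sum. *)
definition sum_metric :: "'a metric \<Rightarrow> 'b metric \<Rightarrow> ('a \<times> 'b) metric" where
  "sum_metric X Y =
     metric (mspace X \<times> mspace Y, \<lambda>(x, y) (u, v). mdist X x u + mdist Y y v)"

lemma Metric_space_sum_metric:
  "Metric_space (mspace X \<times> mspace Y) (\<lambda>(x, y) (u, v). mdist X x u + mdist Y y v)"
proof
  fix p q
  show "0 \<le> (case p of (x, y) \<Rightarrow> \<lambda>(u, v). mdist X x u + mdist Y y v) q"
    by (auto split: prod.split)
  show "(case p of (x, y) \<Rightarrow> \<lambda>(u, v). mdist X x u + mdist Y y v) q =
        (case q of (x, y) \<Rightarrow> \<lambda>(u, v). mdist X x u + mdist Y y v) p"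
    by (auto simp: mdist_commute split: prod.split)
next
  fix p q
  assume "p \<in> mspace X \<times> mspace Y" "q \<in> mspace X \<times> mspace Y"
  then show "((case p of (x, y) \<Rightarrow> \<lambda>(u, v). mdist X x u + mdist Y y v) q = 0) = (p = q)"
    by (auto simp: add_nonneg_eq_0_iff)
next
  fix p q r
  assume "p \<in> mspace X \<times> mspace Y" "q \<in> mspace X \<times> mspace Y" "r \<in> mspace X \<times> mspace Y"
  then obtain x y u v w z where "p = (x, y)" "q = (u, v)" "r = (w, z)"
    and "x \<in> mspace X" "u \<in> mspace X" "w \<in> mspace X"
    and "y \<in> mspace Y" "v \<in> mspace Y" "z \<in> mspace Y"
    by blast
  then show "(case p of (x, y) \<Rightarrow> \<lambda>(u, v). mdist X x u + mdist Y y v) r \<le>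
        (case p of (x, y) \<Rightarrow> \<lambda>(u, v). mdist X x u + mdist Y y v) q +
        (case q of (x, y) \<Rightarrow> \<lambda>(u, v). mdist X x u + mdist Y y v) r"
    using mdist_triangle[of x X u w] mdist_triangle[of y Y v z] by simp
qed

lemma mspace_sum_metric [simp]: "mspace (sum_metric X Y) = mspace X \<times> mspace Y"
  unfolding sum_metric_def by (rule Metric_space.mspace_metric[OF Metric_space_sum_metric])

lemma mdist_sum_metric [simp]:
  "mdist (sum_metric X Y) (x, y) (u, v) = mdist X x u + mdist Y y v"
  unfolding sum_metric_def by (simp add: Metric_space.mdist_metric[OF Metric_space_sum_metric])

definition mixed_monotone ::
  "'a set \<Rightarrow> 'a rel \<Rightarrow> 'b set \<Rightarrow> 'b rel \<Rightarrow> ('a \<times> 'b \<Rightarrow> 'a) \<Rightarrow> ('b \<times> 'a \<Rightarrow> 'b) \<Rightarrow> bool" where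
  "mixed_monotone X P\<^sub>1 Y P\<^sub>2 F G \<longleftrightarrow>
     (\<forall>x\<in>X. \<forall>y\<in>Y.
        (\<forall>x\<^sub>1\<in>X. \<forall>x\<^sub>2\<in>X. (x\<^sub>1, x\<^sub>2) \<in> P\<^sub>1 \<longrightarrow>
           (F (x\<^sub>1, y), F (x\<^sub>2, y)) \<in> P\<^sub>1 \<and> (G (y, x\<^sub>2), G (y, x\<^sub>1)) \<in> P\<^sub>2) \<and>
        (\<forall>y\<^sub>1\<in>Y. \<forall>y\<^sub>2\<in>Y. (y\<^sub>1, y\<^sub>2) \<in> P\<^sub>2 \<longrightarrow>
           (F (x, y\<^sub>2), F (x, y\<^sub>1)) \<in> P\<^sub>1 \<and> (G (y\<^sub>1, x), G (y\<^sub>2, x)) \<in> P\<^sub>2))"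

end

(* Iterating (x, y) \<mapsto> (F(x, y), G(y, x)) from (x0, y0) gives, by mixed monotonicity, an increasing
   sequence in X and a decreasing one in Y, so consecutive iterates stay in the range where the
   contraction hypotheses apply. With r = max (k + l) (m + n) < 1, both step lengths are bounded by
   r ^ n times the larger of the two initial steps. The iterates are therefore Cauchy, and
   continuity of F and G makes the pair of limits a coupled fixed point. *)

theory Submission
  imports Defs
begin

text \<open>The triangle inequality telescopes the steps from \<open>i\<close> to \<open>j\<close>
  into a finite geometric sum. This is at most \<open>C / (1 - r) * r ^ i\<close>, which is
  independent of \<open>j\<close> and tends to 0.\<close>

lemma (in Metric_space) MCauchy_geometric_steps:
  assumes in_M: "range s \<subseteq> M"
    and step: "\<And>i. d (s i) (s (Suc i)) \<le> C * r ^ i"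
    and r: "0 \<le> r" "r < 1"
  shows "MCauchy s"
proof -
  have C: "0 \<le> C"
    using order_trans[OF nonneg step[of 0]] by simp
  have sM: "s i \<in> M" for i
    using in_M by auto
  have partial: "d (s i) (s (i + j)) \<le> C * r ^ i * (\<Sum>t<j. r ^ t)" for i j
  proof (induction j)
    case 0
    then show ?case using sM by simp
  next
    case (Suc j)
    have "d (s i) (s (i + Suc j)) \<le> d (s i) (s (i + j)) + d (s (i + j)) (s (Suc (i + j)))"
      using triangle[OF sM sM sM] by simp
    also have "\<dots> \<le> C * r ^ i * (\<Sum>t<j. r ^ t) + C * r ^ (i + j)"
      by (intro add_mono Suc step)
    also have "\<dots> = C * r ^ i * (\<Sum>t<Suc j. r ^ t)"
      by (simp add: algebra_simps power_add)
    finally show ?case .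
  qed
  have tail: "d (s i) (s j) \<le> C / (1 - r) * r ^ i" if "i \<le> j" for i j
  proof -
    \<comment> \<open>The sum equals \<open>(1 - r ^ (j - i)) / (1 - r)\<close>, and its numerator
      is at most 1.\<close>
    have "(\<Sum>t<j - i. r ^ t) \<le> 1 / (1 - r)"
      using r by (simp add: sum_gp_strict divide_right_mono)
    then have "C * r ^ i * (\<Sum>t<j - i. r ^ t) \<le> C * r ^ i * (1 / (1 - r))"
      using C r by (intro mult_left_mono) auto
    then show ?thesis
      using partial[of i "j - i"] that by simp
  qed
  have "(\<lambda>i. C / (1 - r) * r ^ i) \<longlonglongrightarrow> C / (1 - r) * 0"
    using r by (intro tendsto_mult_left LIMSEQ_power_zero) simp
  then have lim: "(\<lambda>i. C / (1 - r) * r ^ i) \<longlonglongrightarrow> 0"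
    by simp
  show ?thesis
    unfolding MCauchy_def
  proof (intro conjI in_M allI impI)
    fix \<epsilon> :: real
    assume "\<epsilon> > 0"
    then obtain N where N: "\<And>i. i \<ge> N \<Longrightarrow> C / (1 - r) * r ^ i < \<epsilon>"
      using order_tendstoD(2)[OF lim] unfolding eventually_sequentially by blast
    have "d (s i) (s j) < \<epsilon>" if "N \<le> i" "N \<le> j" for i j
    proof (cases "i \<le> j")
      case True
      then show ?thesis using tail[of i j] N[of i] that by simp
    next
      case False
      then show ?thesis using tail[of j i] N[of j] that by (simp add: commute)
    qed
    then show "\<exists>N. \<forall>i j. N \<le> i \<longrightarrow> N \<le> j \<longrightarrow> d (s i) (s j) < \<epsilon>"
      by blast
  qed
qed

text \<open>Turns convergence into a statement about real distances, so that limits in the product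
  metric reduce to sums of null functions.\<close>

lemma limitin_mtopology_of:
  "limitin (mtopology_of X) s l F \<longleftrightarrow>
     l \<in> mspace X \<and> (\<forall>\<^sub>F i in F. s i \<in> mspace X) \<and> ((\<lambda>i. mdist X (s i) l) \<longlongrightarrow> 0) F"
  unfolding mtopology_of_def
  by (rule Metric_space.limitin_metric_dist_null) simp

lemma mcomplete_of_geometric_steps:
  assumes "mcomplete_of X" "range s \<subseteq> mspace X"
    and "\<And>i. mdist X (s i) (s (Suc i)) \<le> C * r ^ i" "0 \<le> r" "r < 1"
  obtains l where "limitin (mtopology_of X) s l sequentially"
proof -
  have "Metric_space.MCauchy (mspace X) (mdist X) s"
    using assms by (intro Metric_space.MCauchy_geometric_steps) auto
  then show thesis
    using assms(1) that
    by (auto simp: mcomplete_of_def Metric_space.mcomplete_def mtopology_of_def)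
qed

lemma limitin_sum_metric:
  assumes "limitin (mtopology_of X) s l F" "limitin (mtopology_of Y) t l' F"
  shows "limitin (mtopology_of (sum_metric X Y)) (\<lambda>i. (s i, t i)) (l, l') F"
  using assms
  by (auto simp: limitin_mtopology_of eventually_conj_iff intro: tendsto_add_zero)

lemma limitin_mtopology_of_unique:
  assumes "limitin (mtopology_of X) s l F" "limitin (mtopology_of X) s l' F" "F \<noteq> bot"
  shows "l = l'"
  using assms unfolding mtopology_of_def
  by (rule Metric_space.limitin_metric_unique[OF Metric_space_mspace_mdist])

text \<open>The shifted sequence still tends to \<open>l\<close>, and by continuity it also tends to
  \<open>f (l, l')\<close>; limits are unique. With \<open>X\<close> and \<open>Y\<close> generic,
  the lemma serves \<open>F\<close> directly and \<open>G\<close> with the two spaces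
  exchanged.\<close>

lemma limitin_iterates_fixpoint:
  assumes "continuous_map (mtopology_of (sum_metric X Y)) (mtopology_of X) f"
    and s: "limitin (mtopology_of X) s l sequentially"
    and t: "limitin (mtopology_of Y) t l' sequentially"
    and rec: "\<And>i. s (Suc i) = f (s i, t i)"
  shows "l = f (l, l')"
proof (rule limitin_mtopology_of_unique)
  show "limitin (mtopology_of X) (\<lambda>i. s (Suc i)) l sequentially"
    using limitin_sequentially_offset[OF s, of 1] by simp
  show "limitin (mtopology_of X) (\<lambda>i. s (Suc i)) (f (l, l')) sequentially"
    using continuous_map_limit[OF assms(1) limitin_sum_metric[OF s t]] by (simp add: rec o_def)
qed simp

theorem theorem2p1:
  fixes X :: "'a metric" and Y :: "'b metric"
    and P\<^sub>1 :: "'a rel" and P\<^sub>2 :: "'b rel"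
    and F :: "'a \<times> 'b \<Rightarrow> 'a" and G :: "'b \<times> 'a \<Rightarrow> 'b"
  assumes "mcomplete_of X" and "partial_order_on (mspace X) P\<^sub>1"
    and "mcomplete_of Y" and "partial_order_on (mspace Y) P\<^sub>2"
    and "continuous_map (mtopology_of (sum_metric X Y)) (mtopology_of X) F"
    and "continuous_map (mtopology_of (sum_metric Y X)) (mtopology_of Y) G"
    and "mixed_monotone (mspace X) P\<^sub>1 (mspace Y) P\<^sub>2 F G"
    and "\<exists>k l m n :: real. k \<in> {0..<1} \<and> l \<in> {0..<1} \<and> m \<in> {0..<1} \<and> n \<in> {0..<1} \<and>
           k + l < 1 \<and> m + n < 1 \<and>
           (\<forall>x\<in>mspace X. \<forall>u\<in>mspace X. \<forall>y\<in>mspace Y. \<forall>v\<in>mspace Y.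
              (u, x) \<in> P\<^sub>1 \<longrightarrow> (y, v) \<in> P\<^sub>2 \<longrightarrow>
              mdist X (F (x, y)) (F (u, v)) \<le> k * mdist X x u + l * mdist Y y v) \<and>
           (\<forall>x\<in>mspace X. \<forall>u\<in>mspace X. \<forall>y\<in>mspace Y. \<forall>v\<in>mspace Y.
              (x, u) \<in> P\<^sub>1 \<longrightarrow> (v, y) \<in> P\<^sub>2 \<longrightarrow>
              mdist Y (G (y, x)) (G (v, u)) \<le> m * mdist Y y v + n * mdist X x u)"
    and "\<exists>x\<^sub>0\<in>mspace X. \<exists>y\<^sub>0\<in>mspace Y. (x\<^sub>0, F (x\<^sub>0, y\<^sub>0)) \<in> P\<^sub>1 \<and> (G (y\<^sub>0, x\<^sub>0), y\<^sub>0) \<in> P\<^sub>2"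
  shows "\<exists>(x, y) \<in> mspace X \<times> mspace Y. x = F (x, y) \<and> y = G (y, x)"
proof -
  obtain k l m n :: real where klmn: "0 \<le> k" "0 \<le> l" "0 \<le> m" "0 \<le> n" "k + l < 1" "m + n < 1"
    and cF: "\<And>x u y v. \<lbrakk>x \<in> mspace X; u \<in> mspace X; y \<in> mspace Y; v \<in> mspace Y;
              (u, x) \<in> P\<^sub>1; (y, v) \<in> P\<^sub>2\<rbrakk> \<Longrightarrow>
              mdist X (F (x, y)) (F (u, v)) \<le> k * mdist X x u + l * mdist Y y v"
    and cG: "\<And>x u y v. \<lbrakk>x \<in> mspace X; u \<in> mspace X; y \<in> mspace Y; v \<in> mspace Y;
              (x, u) \<in> P\<^sub>1; (v, y) \<in> P\<^sub>2\<rbrakk> \<Longrightarrow>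
              mdist Y (G (y, x)) (G (v, u)) \<le> m * mdist Y y v + n * mdist X x u"
    using assms(8)
    unfolding atLeastLessThan_iff
    apply (elim exE conjE)
    subgoal for k l m n by (rule that[of k l m n]; (assumption | blast))
    done
  obtain x\<^sub>0 y\<^sub>0 where init: "x\<^sub>0 \<in> mspace X" "y\<^sub>0 \<in> mspace Y"
      "(x\<^sub>0, F (x\<^sub>0, y\<^sub>0)) \<in> P\<^sub>1" "(G (y\<^sub>0, x\<^sub>0), y\<^sub>0) \<in> P\<^sub>2"
    using assms(9) by blast
  \<comment> \<open>Continuity between topologies includes mapping carrier into carrier.\<close>
  have FX: "F (x, y) \<in> mspace X" and GY: "G (y, x) \<in> mspace Y"
    if "x \<in> mspace X" "y \<in> mspace Y" for x y
    using assms(5,6) that by (auto simp: continuous_map_def Pi_iff)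
  have F1: "(F (x\<^sub>1, y), F (x\<^sub>2, y)) \<in> P\<^sub>1" and G1: "(G (y, x\<^sub>2), G (y, x\<^sub>1)) \<in> P\<^sub>2"
    if "(x\<^sub>1, x\<^sub>2) \<in> P\<^sub>1" "x\<^sub>1 \<in> mspace X" "x\<^sub>2 \<in> mspace X" "y \<in> mspace Y" for x\<^sub>1 x\<^sub>2 y
    using assms(7)[unfolded mixed_monotone_def, rule_format] that by simp_all
  have F2: "(F (x, y\<^sub>2), F (x, y\<^sub>1)) \<in> P\<^sub>1" and G2: "(G (y\<^sub>1, x), G (y\<^sub>2, x)) \<in> P\<^sub>2"
    if "(y\<^sub>1, y\<^sub>2) \<in> P\<^sub>2" "y\<^sub>1 \<in> mspace Y" "y\<^sub>2 \<in> mspace Y" "x \<in> mspace X" for y\<^sub>1 y\<^sub>2 x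
    using assms(7)[unfolded mixed_monotone_def, rule_format] that by simp_all
  have tr1: "trans P\<^sub>1" and tr2: "trans P\<^sub>2"
    using assms(2,4) by (auto simp: partial_order_on_def preorder_on_def)

  \<comment> \<open>Each new component depends on both old ones, so the pair is iterated as a whole
    and then projected.\<close>
  define z where "z i = ((\<lambda>(x, y). (F (x, y), G (y, x))) ^^ i) (x\<^sub>0, y\<^sub>0)" for i
  define x y where "x i = fst (z i)" and "y i = snd (z i)" for i
  have xy0: "x 0 = x\<^sub>0" "y 0 = y\<^sub>0"
    by (simp_all add: x_def y_def z_def)
  have xS: "x (Suc i) = F (x i, y i)" and yS: "y (Suc i) = G (y i, x i)" for i
    by (simp_all add: x_def y_def z_def split: prod.split)
  have xX: "x i \<in> mspace X" and yY: "y i \<in> mspace Y" for i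
    by (induction i) (auto simp: xy0 xS yS init FX GY)
  have mono: "(x i, x (Suc i)) \<in> P\<^sub>1 \<and> (y (Suc i), y i) \<in> P\<^sub>2" for i
  proof (induction i)
    case 0
    then show ?case using init by (simp add: xS yS xy0)
  next
    case (Suc i)
    \<comment> \<open>Mixed monotonicity moves one argument at a time: raising \<open>x\<close> and
      then lowering \<open>y\<close> each raise \<open>F\<close>, and transitivity joins the two.
      The same pair of moves lowers \<open>G\<close>.\<close>
    have "(F (x i, y i), F (x (Suc i), y i)) \<in> P\<^sub>1"
      "(F (x (Suc i), y i), F (x (Suc i), y (Suc i))) \<in> P\<^sub>1"
      using Suc xX yY by (auto intro: F1 F2)
    then have "(x (Suc i), x (Suc (Suc i))) \<in> P\<^sub>1"
      using transD[OF tr1] by (simp flip: xS)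
    moreover have "(G (y (Suc i), x (Suc i)), G (y i, x (Suc i))) \<in> P\<^sub>2"
      "(G (y i, x (Suc i)), G (y i, x i)) \<in> P\<^sub>2"
      using Suc xX yY by (auto intro: G1 G2)
    then have "(y (Suc (Suc i)), y (Suc i)) \<in> P\<^sub>2"
      using transD[OF tr2] by (simp flip: yS)
    ultimately show ?case by blast
  qed

  define r where "r = max (k + l) (m + n)"
  \<comment> \<open>Each contraction inequality mixes distances from both spaces, so a common
    \<open>C\<close> and \<open>r\<close> let one induction carry both bounds.\<close>
  define C where "C = max (mdist X (x 0) (x 1)) (mdist Y (y 0) (y 1))"
  have r: "0 \<le> r" "r < 1" "k + l \<le> r" "m + n \<le> r"
    using klmn by (auto simp: r_def)
  have C: "0 \<le> C"
    by (simp add: C_def le_max_iff_disj)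
  \<comment> \<open>Both \<open>a\<close> and \<open>b\<close> are replaced by their common bound
    \<open>C * r ^ i\<close>; the total weight \<open>p + q \<le> r\<close> then supplies one more
    factor \<open>r\<close>.\<close>
  have weighted: "p * a + q * b \<le> C * r ^ Suc i"
    if "0 \<le> p" "0 \<le> q" "p + q \<le> r" "a \<le> C * r ^ i" "b \<le> C * r ^ i" for p q a b i
  proof -
    have "p * a + q * b \<le> (p + q) * (C * r ^ i)"
      using that by (simp add: distrib_right add_mono mult_left_mono)
    also have "\<dots> \<le> r * (C * r ^ i)"
      using that C r by (intro mult_right_mono) auto
    finally show ?thesis by (simp add: mult_ac)
  qed
  have steps: "mdist X (x i) (x (Suc i)) \<le> C * r ^ i \<and> mdist Y (y i) (y (Suc i)) \<le> C * r ^ i" for i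
  proof (induction i)
    case 0
    then show ?case by (simp add: C_def)
  next
    case (Suc i)
    \<comment> \<open>The hypothesis on \<open>F\<close> wants the larger \<open>x\<close> and the
      smaller \<open>y\<close> in the first pair, so the newer iterate comes first and symmetry
      restores the order afterwards. The hypothesis on \<open>G\<close> has the opposite orientation
      and fits the older iterate first.\<close>
    have "mdist X (x (Suc (Suc i))) (x (Suc i))
        \<le> k * mdist X (x (Suc i)) (x i) + l * mdist Y (y (Suc i)) (y i)"
      using cF[of "x (Suc i)" "x i" "y (Suc i)" "y i"] mono xX yY
      by (simp add: xS[of "Suc i"] flip: xS[of i])
    also have "\<dots> \<le> C * r ^ Suc i"
      using Suc klmn r by (intro weighted) (auto simp: mdist_commute)
    finally have "mdist X (x (Suc i)) (x (Suc (Suc i))) \<le> C * r ^ Suc i"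
      by (simp add: mdist_commute)
    moreover have "mdist Y (y (Suc i)) (y (Suc (Suc i)))
        \<le> m * mdist Y (y i) (y (Suc i)) + n * mdist X (x i) (x (Suc i))"
      using cG[of "x i" "x (Suc i)" "y i" "y (Suc i)"] mono xX yY
      by (simp add: yS[of "Suc i"] flip: yS[of i])
    then have "mdist Y (y (Suc i)) (y (Suc (Suc i))) \<le> C * r ^ Suc i"
      using weighted[of m n] Suc klmn r by (meson order_trans)
    ultimately show ?case by blast
  qed
  obtain a where a: "limitin (mtopology_of X) x a sequentially"
    by (rule mcomplete_of_geometric_steps[OF assms(1), of x C r]) (use steps xX r in auto)
  obtain b where b: "limitin (mtopology_of Y) y b sequentially"
    by (rule mcomplete_of_geometric_steps[OF assms(3), of y C r]) (use steps yY r in auto)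
  have "a = F (a, b)"
    using limitin_iterates_fixpoint[OF assms(5) a b] xS by blast
  moreover have "b = G (b, a)"
    using limitin_iterates_fixpoint[OF assms(6) b a] yS by blast
  moreover have "a \<in> mspace X" "b \<in> mspace Y"
    using a b by (auto simp: limitin_mtopology_of)
  ultimately show ?thesis by auto
qed

end
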